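(* Assume the setting described in the context: $g(x,\cdot)$ is $\sigma$-weakly convex on $Y$ for every $x\in X$ and $\rho\sigma<1$. Let $H_\rho(x,y):=g(x,y)-g_\rho(x,y)$ and, for $\delta\ge0$, $\mathcal F_\delta:=\{(x,y)\in C:H_\rho(x,y)\le\delta\}$. Then, for every $(x,y)\in C$, $$H_\rho(x,y)\ge\frac{1-\rho\sigma}{2\rho}\,\|y-z_\rho(x,y)\|^2 .$$ Moreover, $$\operatorname{dist}\bigl(0,\nabla_yg(x,z_\rho(x,y))+N_Y(z_\rho(x,y))\bigr)\le\frac1\rho\|y-z_\rho(x,y)\|\le\sqrt{\frac{2H_\rho(x,y)}{\rho(1-\rho\sigma)}} .$$ In particular, $$H_\rho(x,y)=0\iff y=z_\rho(x,y)\iff 0\in\nabla_yg(x,y)+N_Y(y).$$ Hence $\mathcal F_0=\{(x,y)\in C:\ y\in\widetilde S(x)\}$, where $\widetilde S(x):=\{y\in Y:0\in\nabla_yg(x,y)+N_Y(y)\}$.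
   Context: $X\subset\mathbb R^n$ and $Y\subset\mathbb R^m$ are nonempty, compact, convex; $C=X\times Y$; $g$ is real-valued and continuously differentiable on a neighborhood of $C$ with $\nabla g$ Lipschitz on $C$. $\sigma$-weak convexity ($\sigma\ge0$) means $g(x,\cdot)+\frac\sigma2\|\cdot\|^2$ is convex on $Y$ for every $x\in X$. For $\rho>0$ with $\rho\sigma<1$, $g_\rho(x,y)=\min_{z\in Y}\{g(x,z)+\frac1{2\rho}\|z-y\|^2\}$, and $z_\rho(x,y)$ is its unique minimizer. $N_Y$ is the normal cone to $Y$ in the sense of convex analysis. *)

theory Defs
  imports "HOL-Analysis.Analysis"
begin

definition gradient :: "('a::real_inner \<Rightarrow> real) \<Rightarrow> 'a \<Rightarrow> 'a" where
  "gradient f x = (THE D. GDERIV f x :> D)"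

lemma gradient_eq: "GDERIV f x :> D \<Longrightarrow> gradient f x = D"
  unfolding gradient_def gderiv_def
  by (rule the_equality, assumption)
     (metis has_derivative_unique inner_commute vector_eq_ldot)

definition C1_near :: "'a::real_inner set \<Rightarrow> ('a \<Rightarrow> real) \<Rightarrow> bool" where
  "C1_near C f \<longleftrightarrow>
     (\<exists>U. open U \<and> C \<subseteq> U \<and> (\<forall>p\<in>U. f differentiable (at p)) \<and> continuous_on U (gradient f))"

definition weakly_convex_on :: "real \<Rightarrow> 'b::real_inner set \<Rightarrow> ('b \<Rightarrow> real) \<Rightarrow> bool" where
  "weakly_convex_on \<sigma> Y f \<longleftrightarrow> convex_on Y (\<lambda>y. f y + \<sigma> / 2 * (norm y)\<^sup>2)"

definition normal_cone :: "'b::real_inner set \<Rightarrow> 'b \<Rightarrow> 'b set" where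
  "normal_cone Y y = (if y \<in> Y then {v. \<forall>w\<in>Y. inner v (w - y) \<le> 0} else {})"

definition prox_objective ::
    "('a \<times> 'b \<Rightarrow> real) \<Rightarrow> real \<Rightarrow> 'a \<Rightarrow> 'b::real_inner \<Rightarrow> 'b \<Rightarrow> real" where
  "prox_objective g \<rho> x y z = g (x, z) + 1 / (2 * \<rho>) * (norm (z - y))\<^sup>2"

(* LEAST over the set of attained values is the minimum itself, not merely the infimum. *)
definition moreau_env ::
    "('a \<times> 'b \<Rightarrow> real) \<Rightarrow> 'b::real_inner set \<Rightarrow> real \<Rightarrow> 'a \<Rightarrow> 'b \<Rightarrow> real" where
  "moreau_env g Y \<rho> x y = (LEAST m. m \<in> prox_objective g \<rho> x y ` Y)"

definition prox_point ::
    "('a \<times> 'b \<Rightarrow> real) \<Rightarrow> 'b::real_inner set \<Rightarrow> real \<Rightarrow> 'a \<Rightarrow> 'b \<Rightarrow> 'b" where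
  "prox_point g Y \<rho> x y = (THE z. is_arg_min (prox_objective g \<rho> x y) (\<lambda>z. z \<in> Y) z)"

definition moreau_gap ::
    "('a \<times> 'b \<Rightarrow> real) \<Rightarrow> 'b::real_inner set \<Rightarrow> real \<Rightarrow> 'a \<Rightarrow> 'b \<Rightarrow> real" where
  "moreau_gap g Y \<rho> x y = g (x, y) - moreau_env g Y \<rho> x y"

definition gap_sublevel ::
    "('a \<times> 'b \<Rightarrow> real) \<Rightarrow> 'a set \<Rightarrow> 'b::real_inner set \<Rightarrow> real \<Rightarrow> real \<Rightarrow> ('a \<times> 'b) set" where
  "gap_sublevel g X Y \<rho> \<delta> = {(x, y). (x, y) \<in> X \<times> Y \<and> moreau_gap g Y \<rho> x y \<le> \<delta>}"

(* Nonempty whenever y lies in Y, since then 0 is a normal vector; hence at points of Y the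
   convention infdist x {} = 0 plays no role. *)
definition stationarity_map ::
    "('a \<times> 'b \<Rightarrow> real) \<Rightarrow> 'b::real_inner set \<Rightarrow> 'a \<Rightarrow> 'b \<Rightarrow> 'b set" where
  "stationarity_map g Y x y = (\<lambda>v. gradient (\<lambda>z. g (x, z)) y + v) ` normal_cone Y y"

definition stationary_points ::
    "('a \<times> 'b \<Rightarrow> real) \<Rightarrow> 'b::real_inner set \<Rightarrow> 'a \<Rightarrow> 'b set" where
  "stationary_points g Y x = {y \<in> Y. 0 \<in> stationarity_map g Y x y}"

end

theory Submission
  imports Defs
begin

text \<open>Adding the quadratic makes the proximal objective strongly convex with modulus
  \<open>\<kappa> = 1 / \<rho> - \<sigma>\<close>. Strong convexity gives quadratic growth \<open>\<kappa> / 2 * \<parallel>y - z\<parallel>\<^sup>2\<close> away from the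
  minimizer \<open>z\<close>, which is the lower bound on the gap at \<open>y\<close>, and the first-order optimality
  condition at \<open>z\<close> exhibits \<open>(y - z) / \<rho>\<close> as an element of \<open>\<nabla>g + N\<^sub>Y\<close>. Conversely, the quadratic
  has zero gradient at \<open>y\<close>, so a stationary \<open>y\<close> satisfies the first-order condition of the proximal
  problem, which is sufficient by convexity.\<close>

section \<open>Strong convexity and quadratic growth at a minimizer\<close>

lemma norm_power2_convex_combination:
  fixes z w :: "'b::real_inner"
  shows "(norm ((1 - t) *\<^sub>R z + t *\<^sub>R w))\<^sup>2
    = (1 - t) * (norm z)\<^sup>2 + t * (norm w)\<^sup>2 - t * (1 - t) * (norm (w - z))\<^sup>2"
  unfolding power2_norm_eq_inner
  by (simp add: inner_add_left inner_add_right inner_diff_left inner_diff_right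
      inner_commute[of w z] algebra_simps)

text \<open>Strong convexity is encoded as convexity after subtracting
  \<open>\<kappa> / 2 * (norm z)\<^sup>2\<close>. The exact convexity defect of the squared norm
  turns this into an inequality with an explicit gain.\<close>

lemma strong_convexity_inequality:
  fixes f :: "'b::real_inner \<Rightarrow> real"
  assumes "convex_on Y (\<lambda>z. f z - \<kappa> / 2 * (norm z)\<^sup>2)"
    and "z \<in> Y" "w \<in> Y" "0 \<le> t" "t \<le> 1"
  shows "f ((1 - t) *\<^sub>R z + t *\<^sub>R w)
    \<le> (1 - t) * f z + t * f w - \<kappa> / 2 * t * (1 - t) * (norm (w - z))\<^sup>2"
  using convex_onD[OF assms(1,4,5,2,3)]
  unfolding norm_power2_convex_combination
  by (simp add: algebra_simps add_divide_distrib diff_divide_distrib)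

text \<open>Move from \<open>z\<close> a fraction \<open>t\<close> of the way to \<open>w\<close>:
  minimality bounds the value there from below, strong convexity from above. Dividing by
  \<open>t\<close> leaves the gain with a factor \<open>1 - t\<close>, which tends to 1 as
  \<open>t\<close> decreases to 0.\<close>

lemma strongly_convex_growth_at_minimum:
  fixes f :: "'b::real_inner \<Rightarrow> real"
  assumes conv: "convex_on Y (\<lambda>z. f z - \<kappa> / 2 * (norm z)\<^sup>2)" and "convex Y"
    and z: "z \<in> Y" and min: "\<And>u. u \<in> Y \<Longrightarrow> f z \<le> f u" and w: "w \<in> Y"
  shows "f z + \<kappa> / 2 * (norm (w - z))\<^sup>2 \<le> f w"
proof -
  have "\<kappa> / 2 * (1 - t) * (norm (w - z))\<^sup>2 \<le> f w - f z" if t: "0 < t" "t < 1" for t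
  proof -
    have "(1 - t) *\<^sub>R z + t *\<^sub>R w \<in> Y"
      using \<open>convex Y\<close> z w t by (simp add: convexD)
    then have "f z \<le> (1 - t) * f z + t * f w - \<kappa> / 2 * t * (1 - t) * (norm (w - z))\<^sup>2"
      using min strong_convexity_inequality[OF conv z w, of t] t by force
    then have "t * (\<kappa> / 2 * (1 - t) * (norm (w - z))\<^sup>2) \<le> t * (f w - f z)"
      by (simp add: algebra_simps)
    then show ?thesis
      using t by simp
  qed
  then have "\<forall>\<^sub>F t in at_right 0. \<kappa> / 2 * (1 - t) * (norm (w - z))\<^sup>2 \<le> f w - f z"
    by (auto intro!: eventually_at_rightI[of 0 1])
  moreover have "((\<lambda>t. \<kappa> / 2 * (1 - t) * (norm (w - z))\<^sup>2)
      \<longlongrightarrow> \<kappa> / 2 * (1 - 0) * (norm (w - z))\<^sup>2) (at_right 0)"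
    by (intro tendsto_intros)
  ultimately have "\<kappa> / 2 * (1 - 0) * (norm (w - z))\<^sup>2 \<le> f w - f z"
    by (intro tendsto_upperbound) auto
  then show ?thesis by simp
qed

section \<open>First-order conditions through one-sided difference quotients along segments\<close>

lemma GDERIV_tendsto_directional:
  fixes f :: "'b::real_inner \<Rightarrow> real"
  assumes "GDERIV f z :> D"
  shows "((\<lambda>t. (f ((1 - t) *\<^sub>R z + t *\<^sub>R w) - f z) / t) \<longlongrightarrow> inner D (w - z)) (at_right 0)"
proof -
  have eq: "(1 - t) *\<^sub>R z + t *\<^sub>R w = z + t *\<^sub>R (w - z)" for t
    by (simp add: algebra_simps)
  have "((\<lambda>t. f (z + t *\<^sub>R (w - z))) has_derivative (\<lambda>t. inner (t *\<^sub>R (w - z)) D)) (at 0)"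
    by (rule has_derivative_compose[where g = f])
       (use assms in \<open>auto simp: gderiv_def intro!: derivative_eq_intros\<close>)
  then have "((\<lambda>t. f (z + t *\<^sub>R (w - z))) has_real_derivative inner D (w - z)) (at 0)"
    by (simp add: has_field_derivative_def inner_commute mult_commute_abs)
  then have "((\<lambda>t. (f (z + t *\<^sub>R (w - z)) - f z) / t) \<longlongrightarrow> inner D (w - z)) (at 0)"
    by (simp add: DERIV_def)
  then show ?thesis
    unfolding eq by (rule tendsto_within_subset) simp
qed

text \<open>By convexity of \<open>Y\<close> the segment from \<open>z\<close> to \<open>w\<close>
  stays in \<open>Y\<close>, so the difference quotients are nonnegative, and so is their
  limit.\<close>

lemma GDERIV_nonneg_at_minimum:
  fixes f :: "'b::real_inner \<Rightarrow> real"
  assumes D: "GDERIV f z :> D" and "convex Y" and z: "z \<in> Y"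
    and min: "\<And>u. u \<in> Y \<Longrightarrow> f z \<le> f u" and w: "w \<in> Y"
  shows "0 \<le> inner D (w - z)"
proof (rule tendsto_lowerbound[OF GDERIV_tendsto_directional[OF D]])
  have "0 \<le> (f ((1 - t) *\<^sub>R z + t *\<^sub>R w) - f z) / t" if "0 < t" "t < 1" for t
    using min[of "(1 - t) *\<^sub>R z + t *\<^sub>R w"] \<open>convex Y\<close> z w that by (simp add: convexD)
  then show "\<forall>\<^sub>F t in at_right 0. 0 \<le> (f ((1 - t) *\<^sub>R z + t *\<^sub>R w) - f z) / t"
    by (auto intro!: eventually_at_rightI[of 0 1])
qed simp

text \<open>Convexity bounds every difference quotient with \<open>0 < t < 1\<close> by
  \<open>f w - f z\<close>; the bound passes to the limit.\<close>

lemma convex_on_GDERIV_le: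
  fixes f :: "'b::real_inner \<Rightarrow> real"
  assumes D: "GDERIV f z :> D" and conv: "convex_on Y f" and z: "z \<in> Y" and w: "w \<in> Y"
  shows "inner D (w - z) \<le> f w - f z"
proof (rule tendsto_upperbound[OF GDERIV_tendsto_directional[OF D]])
  have "(f ((1 - t) *\<^sub>R z + t *\<^sub>R w) - f z) / t \<le> f w - f z" if t: "0 < t" "t < 1" for t
    using convex_onD[OF conv _ _ z w, of t] t by (simp add: field_simps)
  then show "\<forall>\<^sub>F t in at_right 0. (f ((1 - t) *\<^sub>R z + t *\<^sub>R w) - f z) / t \<le> f w - f z"
    by (auto intro!: eventually_at_rightI[of 0 1])
qed simp

section \<open>Gradients of the partial functions and of the proximal objective\<close>

lemma differentiable_imp_GDERIV_gradient:
  fixes f :: "'b::euclidean_space \<Rightarrow> real"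
  assumes "f differentiable (at z)"
  shows "GDERIV f z :> gradient f z"
proof -
  obtain f' where f': "(f has_derivative f') (at z)"
    using assms by (auto simp: differentiable_def)
  \<comment> \<open>The vector representing a linear functional on a Euclidean space is its adjoint
    evaluated at 1.\<close>
  then have "f' = (\<lambda>h. inner h (adjoint f' 1))"
    using adjoint_works[of f' _ 1] has_derivative_linear[OF f'] by auto
  with f' have "GDERIV f z :> adjoint f' 1"
    unfolding gderiv_def by metis
  then show ?thesis
    by (simp add: gradient_eq)
qed

text \<open>\<open>stationarity_map\<close> takes the gradient of a partial function, whereas
  \<open>C1_near\<close> concerns \<open>g\<close> on the product; the chain rule along the
  inclusion of \<open>z\<close> as \<open>(x, z)\<close> links the two.\<close>

lemma C1_near_GDERIV_snd:
  fixes g :: "'a::real_inner \<times> 'b::euclidean_space \<Rightarrow> real"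
  assumes "C1_near (X \<times> Y) g" "x \<in> X" "z \<in> Y"
  shows "GDERIV (\<lambda>z. g (x, z)) z :> gradient (\<lambda>z. g (x, z)) z"
proof (rule differentiable_imp_GDERIV_gradient)
  have "g differentiable (at (x, z))"
    using assms by (auto simp: C1_near_def)
  then obtain g' where "(g has_derivative g') (at (x, z))"
    by (auto simp: differentiable_def)
  then have "((\<lambda>z. g (x, z)) has_derivative (\<lambda>h. g' (0, h))) (at z)"
    by (rule has_derivative_compose[OF has_derivative_Pair[OF has_derivative_const has_derivative_ident]])
  then show "(\<lambda>z. g (x, z)) differentiable (at z)"
    by (auto simp: differentiable_def)
qed

lemma GDERIV_prox_objective:
  fixes g :: "'a \<times> 'b::real_inner \<Rightarrow> real"
  assumes "GDERIV (\<lambda>z. g (x, z)) z :> D"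
  shows "GDERIV (prox_objective g \<rho> x y) z :> D + (1 / \<rho>) *\<^sub>R (z - y)"
proof -
  \<comment> \<open>Writing the squared norm as an inner product lets the product rule cover
    \<open>z = y\<close> too, where the norm itself need not be differentiable.\<close>
  have "((\<lambda>z. g (x, z) + c * inner (z - y) (z - y)) has_derivative
      (\<lambda>h. inner h D + c * (inner (z - y) h + inner h (z - y)))) (at z)" for c
    using assms unfolding gderiv_def
    by (intro has_derivative_add has_derivative_mult_right has_derivative_inner)
       (auto intro!: derivative_eq_intros)
  from this[of "1 / (2 * \<rho>)"]
  have "((\<lambda>z. g (x, z) + 1 / (2 * \<rho>) * inner (z - y) (z - y)) has_derivative
      (\<lambda>h. inner h D + 1 / (2 * \<rho>) * (inner (z - y) h + inner h (z - y)))) (at z)" .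
  moreover have "(\<lambda>h. inner h D + 1 / (2 * \<rho>) * (inner (z - y) h + inner h (z - y)))
      = (\<lambda>h. inner h (D + (1 / \<rho>) *\<^sub>R (z - y)))"
    by (simp add: inner_add_right inner_commute[of "z - y"] fun_eq_iff)
  ultimately show ?thesis
    by (simp add: gderiv_def prox_objective_def[abs_def] power2_norm_eq_inner)
qed

text \<open>Expanding the square and subtracting the quadratic of modulus
  \<open>1 / \<rho> - \<sigma>\<close> leaves
  \<open>g (x, z) + \<sigma> / 2 * (norm z)\<^sup>2\<close>, convex by weak convexity, plus an
  affine function of \<open>z\<close>.\<close>

lemma prox_objective_strongly_convex:
  fixes g :: "'a \<times> 'b::real_inner \<Rightarrow> real"
  assumes "weakly_convex_on \<sigma> Y (\<lambda>z. g (x, z))"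
  shows "convex_on Y (\<lambda>z. prox_objective g \<rho> x y z - (1 / \<rho> - \<sigma>) / 2 * (norm z)\<^sup>2)"
proof -
  have conv: "convex_on Y (\<lambda>z. g (x, z) + \<sigma> / 2 * (norm z)\<^sup>2)"
    using assms by (simp add: weakly_convex_on_def)
  then have "convex Y"
    by (rule convex_on_imp_convex)
  have "convex_on Y (\<lambda>z. (norm y)\<^sup>2 / (2 * \<rho>) - inner z y / \<rho>)"
    using \<open>convex Y\<close>
    by (auto intro!: convex_onI simp: inner_add_left diff_divide_distrib algebra_simps add_divide_distrib)
  with conv have "convex_on Y (\<lambda>z. (g (x, z) + \<sigma> / 2 * (norm z)\<^sup>2)
      + ((norm y)\<^sup>2 / (2 * \<rho>) - inner z y / \<rho>))"
    by (rule convex_on_add)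
  moreover have "(g (x, z) + \<sigma> / 2 * (norm z)\<^sup>2) + ((norm y)\<^sup>2 / (2 * \<rho>) - inner z y / \<rho>)
      = prox_objective g \<rho> x y z - (1 / \<rho> - \<sigma>) / 2 * (norm z)\<^sup>2" for z
    unfolding prox_objective_def power2_norm_eq_inner
    by (simp add: inner_diff_left inner_diff_right inner_commute[of y z]
        add_divide_distrib diff_divide_distrib algebra_simps)
  ultimately show ?thesis by simp
qed

section \<open>The proximal point and the Moreau envelope as a genuine minimizer and minimum\<close>

lemma prox_point_eqI:
  fixes g :: "'a \<times> 'b::real_inner \<Rightarrow> real"
  assumes wc: "weakly_convex_on \<sigma> Y (\<lambda>z. g (x, z))" and "\<rho> > 0" "\<rho> * \<sigma> < 1"
    and z: "z \<in> Y" and min: "\<And>w. w \<in> Y \<Longrightarrow> prox_objective g \<rho> x y z \<le> prox_objective g \<rho> x y w"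
  shows "prox_point g Y \<rho> x y = z"
  unfolding prox_point_def
proof (rule the_equality)
  show "is_arg_min (prox_objective g \<rho> x y) (\<lambda>z. z \<in> Y) z"
    using z min by (auto simp: is_arg_min_linorder)
next
  fix w
  assume "is_arg_min (prox_objective g \<rho> x y) (\<lambda>z. z \<in> Y) w"
  then have w: "w \<in> Y" "prox_objective g \<rho> x y w \<le> prox_objective g \<rho> x y z"
    using z by (auto simp: is_arg_min_linorder)
  have conv: "convex_on Y (\<lambda>z. prox_objective g \<rho> x y z - (1 / \<rho> - \<sigma>) / 2 * (norm z)\<^sup>2)"
    by (rule prox_objective_strongly_convex[OF wc])
  \<comment> \<open>Quadratic growth from \<open>z\<close>, applied at a second minimizer
    \<open>w\<close>, leaves no room for a positive distance.\<close>
  have "(1 / \<rho> - \<sigma>) / 2 * (norm (w - z))\<^sup>2 \<le> 0"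
    using strongly_convex_growth_at_minimum[OF conv convex_on_imp_convex[OF conv] z min w(1)] w(2)
    by linarith
  moreover have "0 < (1 / \<rho> - \<sigma>) / 2"
    using assms(2,3) by (simp add: field_simps)
  ultimately show "w = z"
    by (simp add: mult_le_0_iff)
qed

lemma moreau_env_eqI:
  assumes "z \<in> Y" "\<And>w. w \<in> Y \<Longrightarrow> prox_objective g \<rho> x y z \<le> prox_objective g \<rho> x y w"
  shows "moreau_env g Y \<rho> x y = prox_objective g \<rho> x y z"
  unfolding moreau_env_def using assms by (intro Least_equality) auto

text \<open>A definite description is usable only once existence and uniqueness are known:
  compactness and continuity give a minimizer, and \<open>prox_point_eqI\<close> identifies it with
  \<open>prox_point\<close>.\<close>

lemma prox_point_minimizes:
  fixes g :: "'a \<times> 'b::real_inner \<Rightarrow> real"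
  assumes wc: "weakly_convex_on \<sigma> Y (\<lambda>z. g (x, z))" and "\<rho> > 0" "\<rho> * \<sigma> < 1"
    and "compact Y" "Y \<noteq> {}" and cont: "continuous_on Y (\<lambda>z. g (x, z))"
  shows "prox_point g Y \<rho> x y \<in> Y"
    and "w \<in> Y \<Longrightarrow> prox_objective g \<rho> x y (prox_point g Y \<rho> x y) \<le> prox_objective g \<rho> x y w"
proof -
  have "continuous_on Y (prox_objective g \<rho> x y)"
    unfolding prox_objective_def[abs_def] by (intro continuous_intros cont)
  then obtain z where z: "z \<in> Y" "\<And>w. w \<in> Y \<Longrightarrow> prox_objective g \<rho> x y z \<le> prox_objective g \<rho> x y w"
    using continuous_attains_inf[OF \<open>compact Y\<close> \<open>Y \<noteq> {}\<close>] by metis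
  then have "prox_point g Y \<rho> x y = z"
    by (rule prox_point_eqI[OF assms(1-3)])
  with z show "prox_point g Y \<rho> x y \<in> Y"
    and "w \<in> Y \<Longrightarrow> prox_objective g \<rho> x y (prox_point g Y \<rho> x y) \<le> prox_objective g \<rho> x y w"
    by auto
qed

section \<open>The lower bound for the gap, and its zeros\<close>

lemma moreau_gap_lower_bound:
  fixes g :: "'a \<times> 'b::real_inner \<Rightarrow> real"
  assumes wc: "weakly_convex_on \<sigma> Y (\<lambda>z. g (x, z))" and "\<rho> > 0" "\<rho> * \<sigma> < 1"
    and "compact Y" and cont: "continuous_on Y (\<lambda>z. g (x, z))" and y: "y \<in> Y"
  shows "(1 - \<rho> * \<sigma>) / (2 * \<rho>) * (norm (y - prox_point g Y \<rho> x y))\<^sup>2 \<le> moreau_gap g Y \<rho> x y"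
proof -
  let ?z = "prox_point g Y \<rho> x y"
  have "Y \<noteq> {}" using y by auto
  note z = prox_point_minimizes[OF assms(1-4) this cont, where y = y]
  have conv: "convex_on Y (\<lambda>z. prox_objective g \<rho> x y z - (1 / \<rho> - \<sigma>) / 2 * (norm z)\<^sup>2)"
    by (rule prox_objective_strongly_convex[OF wc])
  have "prox_objective g \<rho> x y ?z + (1 / \<rho> - \<sigma>) / 2 * (norm (y - ?z))\<^sup>2 \<le> prox_objective g \<rho> x y y"
    by (rule strongly_convex_growth_at_minimum[OF conv convex_on_imp_convex[OF conv] z y])
  moreover have "(1 / \<rho> - \<sigma>) / 2 = (1 - \<rho> * \<sigma>) / (2 * \<rho>)"
    using \<open>\<rho> > 0\<close> by (simp add: field_simps)
  \<comment> \<open>The quadratic vanishes at \<open>y\<close>, so the gap is the excess of the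
    objective at \<open>y\<close> over its minimum.\<close>
  moreover have "moreau_gap g Y \<rho> x y = prox_objective g \<rho> x y y - prox_objective g \<rho> x y ?z"
    using moreau_env_eqI[OF z] by (simp add: moreau_gap_def prox_objective_def)
  ultimately show ?thesis by simp
qed

lemma moreau_gap_eq_0_iff:
  fixes g :: "'a \<times> 'b::real_inner \<Rightarrow> real"
  assumes wc: "weakly_convex_on \<sigma> Y (\<lambda>z. g (x, z))" and "\<rho> > 0" "\<rho> * \<sigma> < 1"
    and "compact Y" and cont: "continuous_on Y (\<lambda>z. g (x, z))" and y: "y \<in> Y"
  shows "moreau_gap g Y \<rho> x y = 0 \<longleftrightarrow> y = prox_point g Y \<rho> x y"
proof
  assume "moreau_gap g Y \<rho> x y = 0"
  then have "(1 - \<rho> * \<sigma>) / (2 * \<rho>) * (norm (y - prox_point g Y \<rho> x y))\<^sup>2 \<le> 0"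
    using moreau_gap_lower_bound[OF assms] by simp
  moreover have "0 < (1 - \<rho> * \<sigma>) / (2 * \<rho>)"
    using assms(2,3) by simp
  ultimately show "y = prox_point g Y \<rho> x y"
    by (simp only: mult_le_0_iff) auto
next
  assume eq: "y = prox_point g Y \<rho> x y"
  have "Y \<noteq> {}" using y by auto
  note z = prox_point_minimizes[OF assms(1-4) this cont, where y = y]
  have "moreau_env g Y \<rho> x y = prox_objective g \<rho> x y (prox_point g Y \<rho> x y)"
    by (rule moreau_env_eqI[OF z])
  with eq have "moreau_env g Y \<rho> x y = prox_objective g \<rho> x y y"
    by simp
  then show "moreau_gap g Y \<rho> x y = 0"
    by (simp add: moreau_gap_def prox_objective_def)
qed

section \<open>Stationarity at the proximal point and at its fixed points\<close>

lemma prox_residual_in_stationarity_map: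
  fixes g :: "'a \<times> 'b::real_inner \<Rightarrow> real"
  assumes wc: "weakly_convex_on \<sigma> Y (\<lambda>z. g (x, z))" and "\<rho> > 0" "\<rho> * \<sigma> < 1"
    and "compact Y" "Y \<noteq> {}"
    and D: "\<And>z. z \<in> Y \<Longrightarrow> GDERIV (\<lambda>z. g (x, z)) z :> gradient (\<lambda>z. g (x, z)) z"
    and cont: "continuous_on Y (\<lambda>z. g (x, z))"
  shows "(1 / \<rho>) *\<^sub>R (y - prox_point g Y \<rho> x y)
    \<in> stationarity_map g Y x (prox_point g Y \<rho> x y)"
proof -
  let ?z = "prox_point g Y \<rho> x y"
  let ?D = "gradient (\<lambda>z. g (x, z)) ?z"
  note z = prox_point_minimizes[OF assms(1-5) cont, where y = y]
  have "convex Y"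
    using wc by (auto simp: weakly_convex_on_def dest: convex_on_imp_convex)
  have "0 \<le> inner (?D + (1 / \<rho>) *\<^sub>R (?z - y)) (w - ?z)" if "w \<in> Y" for w
    by (rule GDERIV_nonneg_at_minimum[OF GDERIV_prox_objective[OF D[OF z(1)]] \<open>convex Y\<close> z that])
  then have "inner ((1 / \<rho>) *\<^sub>R (y - ?z) - ?D) (w - ?z) \<le> 0" if "w \<in> Y" for w
    using that by (fastforce simp: inner_add_left inner_diff_left diff_divide_distrib)
  \<comment> \<open>The variational inequality says that the negative gradient of the objective is
    normal to \<open>Y\<close> at the minimizer; adding \<open>?D\<close> back leaves the scaled
    residual.\<close>
  then have "(1 / \<rho>) *\<^sub>R (y - ?z) - ?D \<in> normal_cone Y ?z"
    using z(1) by (simp add: normal_cone_def)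
  then show ?thesis
    unfolding stationarity_map_def by (rule rev_image_eqI) simp
qed

lemma prox_point_eq_iff_stationary:
  fixes g :: "'a \<times> 'b::real_inner \<Rightarrow> real"
  assumes wc: "weakly_convex_on \<sigma> Y (\<lambda>z. g (x, z))" and "\<rho> > 0" "\<rho> * \<sigma> < 1"
    and "compact Y"
    and D: "\<And>z. z \<in> Y \<Longrightarrow> GDERIV (\<lambda>z. g (x, z)) z :> gradient (\<lambda>z. g (x, z)) z"
    and cont: "continuous_on Y (\<lambda>z. g (x, z))" and y: "y \<in> Y"
  shows "y = prox_point g Y \<rho> x y \<longleftrightarrow> 0 \<in> stationarity_map g Y x y"
proof
  have "Y \<noteq> {}" using y by auto
  assume "y = prox_point g Y \<rho> x y"
  \<comment> \<open>At a fixed point the residual is 0.\<close>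
  with prox_residual_in_stationarity_map[OF assms(1-4) \<open>Y \<noteq> {}\<close> D cont, of y]
  show "0 \<in> stationarity_map g Y x y" by simp
next
  assume "0 \<in> stationarity_map g Y x y"
  then have "- gradient (\<lambda>z. g (x, z)) y \<in> normal_cone Y y"
    by (auto simp: stationarity_map_def add_eq_0_iff)
  then have stat: "0 \<le> inner (gradient (\<lambda>z. g (x, z)) y) (w - y)" if "w \<in> Y" for w
    using y that by (fastforce simp: normal_cone_def)
  let ?\<kappa> = "(1 / \<rho> - \<sigma>) / 2"
  have "0 \<le> ?\<kappa>"
    using assms(2,3) by (simp add: field_simps)
  \<comment> \<open>Since \<open>\<rho> * \<sigma> < 1\<close>, the gain in the strong convexity
    inequality is nonnegative; dropping it gives plain convexity.\<close>
  have conv: "convex_on Y (prox_objective g \<rho> x y)"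
  proof -
    have sc: "convex_on Y (\<lambda>z. prox_objective g \<rho> x y z - (1 / \<rho> - \<sigma>) / 2 * (norm z)\<^sup>2)"
      by (rule prox_objective_strongly_convex[OF wc])
    show ?thesis
    proof (rule convex_onI)
      fix t :: real and z w assume t: "0 < t" "t < 1" and "z \<in> Y" "w \<in> Y"
      have "0 \<le> ?\<kappa> * t * (1 - t) * (norm (w - z))\<^sup>2"
        using \<open>0 \<le> ?\<kappa>\<close> t by (intro mult_nonneg_nonneg) auto
      then show "prox_objective g \<rho> x y ((1 - t) *\<^sub>R z + t *\<^sub>R w)
          \<le> (1 - t) * prox_objective g \<rho> x y z + t * prox_objective g \<rho> x y w"
        using strong_convexity_inequality[OF sc \<open>z \<in> Y\<close> \<open>w \<in> Y\<close>, of t] t by linarith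
    qed (rule convex_on_imp_convex[OF sc])
  qed
  have "GDERIV (prox_objective g \<rho> x y) y :> gradient (\<lambda>z. g (x, z)) y"
    using GDERIV_prox_objective[OF D[OF y], of \<rho> y] by simp
  \<comment> \<open>The gradient inequality at \<open>y\<close> turns nonnegative slopes into global
    minimality over \<open>Y\<close>.\<close>
  then have "prox_objective g \<rho> x y y \<le> prox_objective g \<rho> x y w" if "w \<in> Y" for w
    using convex_on_GDERIV_le[OF _ conv y that] stat[OF that] by force
  then show "y = prox_point g Y \<rho> x y"
    using prox_point_eqI[OF assms(1-3) y] by simp
qed

theorem proposition12:
  fixes X :: "'a::euclidean_space set" and Y :: "'b::euclidean_space set"
    and g :: "'a \<times> 'b \<Rightarrow> real" and \<sigma> \<rho> :: real
  assumes "X \<noteq> {}" and "compact X" and "convex X"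
    and "Y \<noteq> {}" and "compact Y" and "convex Y"
    and "C1_near (X \<times> Y) g"
    and "\<exists>L. L-lipschitz_on (X \<times> Y) (gradient g)"
    and "\<sigma> \<ge> 0" and "\<forall>x\<in>X. weakly_convex_on \<sigma> Y (\<lambda>y. g (x, y))"
    and "\<rho> > 0" and "\<rho> * \<sigma> < 1"
  shows "(\<forall>x\<in>X. \<forall>y\<in>Y.
      moreau_gap g Y \<rho> x y \<ge> (1 - \<rho> * \<sigma>) / (2 * \<rho>) * (norm (y - prox_point g Y \<rho> x y))\<^sup>2
    \<and> infdist 0 (stationarity_map g Y x (prox_point g Y \<rho> x y))
        \<le> 1 / \<rho> * norm (y - prox_point g Y \<rho> x y)
    \<and> 1 / \<rho> * norm (y - prox_point g Y \<rho> x y)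
        \<le> sqrt (2 * moreau_gap g Y \<rho> x y / (\<rho> * (1 - \<rho> * \<sigma>)))
    \<and> (moreau_gap g Y \<rho> x y = 0 \<longleftrightarrow> y = prox_point g Y \<rho> x y)
    \<and> (y = prox_point g Y \<rho> x y \<longleftrightarrow> 0 \<in> stationarity_map g Y x y))
    \<and> gap_sublevel g X Y \<rho> 0 = {(x, y). (x, y) \<in> X \<times> Y \<and> y \<in> stationary_points g Y x}"
proof -
  have pointwise: "moreau_gap g Y \<rho> x y \<ge> (1 - \<rho> * \<sigma>) / (2 * \<rho>) * (norm (y - prox_point g Y \<rho> x y))\<^sup>2
    \<and> infdist 0 (stationarity_map g Y x (prox_point g Y \<rho> x y))
        \<le> 1 / \<rho> * norm (y - prox_point g Y \<rho> x y)
    \<and> 1 / \<rho> * norm (y - prox_point g Y \<rho> x y)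
        \<le> sqrt (2 * moreau_gap g Y \<rho> x y / (\<rho> * (1 - \<rho> * \<sigma>)))
    \<and> (moreau_gap g Y \<rho> x y = 0 \<longleftrightarrow> y = prox_point g Y \<rho> x y)
    \<and> (y = prox_point g Y \<rho> x y \<longleftrightarrow> 0 \<in> stationarity_map g Y x y)"
    (is "?bound \<and> ?dist \<and> ?root \<and> ?gap0 \<and> ?stat") if x: "x \<in> X" and y: "y \<in> Y" for x y
  proof (intro conjI)
    let ?z = "prox_point g Y \<rho> x y"
    have wc: "weakly_convex_on \<sigma> Y (\<lambda>z. g (x, z))"
      using assms(10) x by blast
    have D: "GDERIV (\<lambda>z. g (x, z)) z :> gradient (\<lambda>z. g (x, z)) z" if "z \<in> Y" for z
      by (rule C1_near_GDERIV_snd[OF assms(7) x that])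
    have cont: "continuous_on Y (\<lambda>z. g (x, z))"
      using D by (intro continuous_at_imp_continuous_on) (auto simp: gderiv_def intro: has_derivative_continuous)
    show bound: ?bound
      by (rule moreau_gap_lower_bound[OF wc assms(11,12,5) cont y])
    \<comment> \<open>The distance is at most the norm of any one element, here the scaled
      residual.\<close>
    have "infdist 0 (stationarity_map g Y x ?z) \<le> dist 0 ((1 / \<rho>) *\<^sub>R (y - ?z))"
      by (rule infdist_le[OF prox_residual_in_stationarity_map[OF wc assms(11,12,5,4) D cont]])
    then show ?dist
      using assms(11) by simp
    have pos: "0 < \<rho> * (1 - \<rho> * \<sigma>)"
      using assms(11,12) by simp
    \<comment> \<open>The factor \<open>2 / (\<rho> * (1 - \<rho> * \<sigma>))\<close> is chosen to
      turn the constant of the gap bound into exactly \<open>1 / \<rho>\<^sup>2\<close>.\<close>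
    have "(1 / \<rho> * norm (y - ?z))\<^sup>2
        = 2 * ((1 - \<rho> * \<sigma>) / (2 * \<rho>) * (norm (y - ?z))\<^sup>2) / (\<rho> * (1 - \<rho> * \<sigma>))"
      using pos assms(11,12) by (simp add: power2_eq_square)
    also have "\<dots> \<le> 2 * moreau_gap g Y \<rho> x y / (\<rho> * (1 - \<rho> * \<sigma>))"
      using bound pos by (intro divide_right_mono mult_left_mono) auto
    finally show ?root
      by (rule real_le_rsqrt)
    show ?gap0
      by (rule moreau_gap_eq_0_iff[OF wc assms(11,12,5) cont y])
    show ?stat
      by (rule prox_point_eq_iff_stationary[OF wc assms(11,12,5) D cont y])
  qed
  have "moreau_gap g Y \<rho> x y \<le> 0 \<longleftrightarrow> y \<in> stationary_points g Y x" if "x \<in> X" "y \<in> Y" for x y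
  proof -
    \<comment> \<open>The lower bound makes the gap nonnegative, so its sublevel set at 0 is its
      zero set.\<close>
    have "0 \<le> (1 - \<rho> * \<sigma>) / (2 * \<rho>) * (norm (y - prox_point g Y \<rho> x y))\<^sup>2"
      using assms(11,12) by simp
    then have "0 \<le> moreau_gap g Y \<rho> x y"
      using pointwise[OF that] by linarith
    then have "moreau_gap g Y \<rho> x y \<le> 0 \<longleftrightarrow> moreau_gap g Y \<rho> x y = 0"
      by linarith
    then show ?thesis
      using pointwise[OF that] that(2) by (simp add: stationary_points_def)
  qed
  then have "gap_sublevel g X Y \<rho> 0 = {(x, y). (x, y) \<in> X \<times> Y \<and> y \<in> stationary_points g Y x}"
    by (auto simp: gap_sublevel_def)
  with pointwise show ?thesis by blast
qed

end
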